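(* Let $G$ be a connected graph of diameter $d\ge 4$ with minimum degree at least two. Then $\operatorname{th}_-(G)\ge \sqrt d-\frac14$.
   Context: Graphs are finite, simple and undirected. Skew zero forcing: each vertex of $G$ is blue or white; initially exactly the vertices of a set $S\subseteq V(G)$ are blue. In each round, simultaneously, every vertex (blue or white) that has exactly one white neighbor at the start of the round colors that neighbor blue. If all vertices eventually become blue, $S$ is a skew zero forcing set, and the skew propagation time $\operatorname{pt}_-(G;S)$ is the number of rounds needed until all vertices are blue ($0$ if $S=V(G)$); otherwise $\operatorname{pt}_-(G;S)=\infty$. Define $\operatorname{th}_-(G;S)=|S|+\operatorname{pt}_-(G;S)$ and the skew throttling number $\operatorname{th}_-(G)=\min_{S\subseteq V(G)}\operatorname{th}_-(G;S)$. *)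

theory Defs
  imports "Graph_Theory.Graph_Theory" "HOL-Library.Extended_Nat" "HOL-Library.Extended_Real"
begin

text \<open>
  A finite simple undirected graph is an instance of the locale \<^locale>\<open>graph\<close>: a finite
  symmetric digraph without loops and without parallel arcs.  Each undirected edge is a pair of
  opposite arcs, so the degree of a vertex is its out-degree.
\<close>

definition min_degree :: "('a, 'b) pre_digraph \<Rightarrow> nat" where
  "min_degree G = Min (out_degree G ` verts G)"

text \<open>
  With all arc costs equal to 1, the shortest-path cost is the usual graph distance
  (\<open>\<infinity>\<close> between different components).
\<close>

definition graph_dist :: "('a, 'b) pre_digraph \<Rightarrow> 'a \<Rightarrow> 'a \<Rightarrow> ereal" where
  "graph_dist G u v = wf_digraph.\<mu> G (\<lambda>_. 1) u v"

definition diameter :: "('a, 'b) pre_digraph \<Rightarrow> ereal" where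
  "diameter G = (SUP u\<in>verts G. SUP v\<in>verts G. graph_dist G u v)"

definition neighbors :: "('a, 'b) pre_digraph \<Rightarrow> 'a \<Rightarrow> 'a set" where
  "neighbors G v = {w. v \<rightarrow>\<^bsub>G\<^esub> w}"

text \<open>
  The blue set after one simultaneous round from the blue set \<open>B\<close>.  The forcing vertex \<open>v\<close> need
  not be blue.
\<close>

definition skew_round :: "('a, 'b) pre_digraph \<Rightarrow> 'a set \<Rightarrow> 'a set" where
  "skew_round G B = B \<union> {w. \<exists>v\<in>verts G. neighbors G v - B = {w}}"

text \<open>
  The infimum of the empty set in \<^typ>\<open>enat\<close> is \<open>\<infinity>\<close>, which is the value when \<open>S\<close> is not a skew
  zero forcing set; every nonempty set in \<^typ>\<open>enat\<close> attains its infimum.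
\<close>

definition skew_prop_time :: "('a, 'b) pre_digraph \<Rightarrow> 'a set \<Rightarrow> enat" where
  "skew_prop_time G S = (INF k\<in>{k. (skew_round G ^^ k) S = verts G}. enat k)"

definition skew_throttling_of :: "('a, 'b) pre_digraph \<Rightarrow> 'a set \<Rightarrow> enat" where
  "skew_throttling_of G S = enat (card S) + skew_prop_time G S"

definition skew_throttling_number :: "('a, 'b) pre_digraph \<Rightarrow> enat" where
  "skew_throttling_number G = (INF S\<in>Pow (verts G). skew_throttling_of G S)"

end

theory Submission
  imports Defs
begin

text \<open>
  Because every degree is at least two, a vertex that forces always has a neighbor that is already
  blue. A vertex forced in round \<open>i\<close> is therefore at distance at most 2 from a vertex that was
  blue before, so after \<open>t\<close> rounds every blue vertex lies within distance \<open>2t\<close> of \<open>S\<close>. Sort the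
  vertices by their distance from an endpoint of a diametral pair: all levels \<open>0, \<dots>, d\<close> occur,
  and a ball of radius \<open>2t\<close> meets at most \<open>4t + 1\<close> of them. Hence \<open>d + 1 \<le> s(4t + 1)\<close> with
  \<open>s = |S|\<close>, and \<open>s(4t + 1) \<le> (s + t + 1/4)\<^sup>2\<close> by AM-GM.
\<close>

text \<open>A shortest path attains the distance, and with unit costs its cost is its length. This
  lets levels be natural numbers.\<close>

lemma (in fin_digraph) graph_dist_eq_nat:
  assumes "u \<rightarrow>\<^sup>* v"
  shows "\<exists>n::nat. graph_dist G u v = ereal (real n)"
proof -
  obtain p where "apath u p v" and p: "graph_dist G u v = ereal (awalk_cost (\<lambda>_. 1) p)"
    using min_cost_awalk[OF assms, of "\<lambda>_. 1"] by (auto simp: graph_dist_def)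
  have "awalk_cost (\<lambda>_. 1) p = real (length p)"
    by (induction p) simp_all
  with p show ?thesis by auto
qed

lemma (in fin_digraph) graph_dist_adj:
  assumes "v \<rightarrow>\<^bsub>G\<^esub> w"
  shows "graph_dist G u w \<le> graph_dist G u v + 1"
proof -
  from assms obtain e where "arc_to_ends G e = (v, w)" "e \<in> arcs G"
    by (auto simp: arcs_ends_def)
  from pos_cost_mu_triangle[OF _ this, of "\<lambda>_. 1" u] show ?thesis
    by (simp add: graph_dist_def one_ereal_def)
qed

lemma graph_dist_self:
  assumes "wf_digraph G" "u \<in> verts G"
  shows "graph_dist G u u \<le> 0"
proof -
  interpret wf_digraph G by fact
  have "awalk u [] u" using assms by (simp add: awalk_Nil_iff)
  from min_cost_le_walk_cost[OF this, of "\<lambda>_. 1"] show ?thesis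
    by (simp add: graph_dist_def zero_ereal_def)
qed

text \<open>A discrete intermediate value argument: along a walk from level 0 each arc climbs by at
  most one, so at each step \<open>f y\<close> is the only level that can be new.\<close>

lemma (in wf_digraph) reachable_all_levels:
  fixes f :: "'a \<Rightarrow> nat"
  assumes "u \<rightarrow>\<^sup>* v" "f u = 0"
    and step: "\<And>x y. x \<rightarrow>\<^bsub>G\<^esub> y \<Longrightarrow> f y \<le> f x + 1"
  shows "{..f v} \<subseteq> f ` verts G"
  using assms(1)
proof (induction rule: reachable_induct)
  case base
  then show ?case using \<open>f u = 0\<close> by force
next
  case (step x y)
  have "f y \<in> f ` verts G" using step.hyps by (blast dest: adj_in_verts)
  moreover have "{..f y} \<subseteq> insert (f y) {..f x}"
    using assms(3)[OF step.hyps(2)] by auto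
  ultimately show ?case using step.IH by blast
qed

lemma (in nomulti_digraph) card_neighbors: "card (neighbors G v) = out_degree G v"
proof -
  have "neighbors G v = head G ` out_arcs G v"
    by (auto simp: neighbors_def arcs_ends_conv)
  moreover have "inj_on (head G) (out_arcs G v)"
    by (auto intro!: inj_onI no_multi_arcs simp: arc_to_ends_def)
  ultimately show ?thesis by (simp add: card_image out_degree_def)
qed

text \<open>Measuring nearness through a function that changes by at most 1 along arcs replaces
  balls in the graph by intervals of integers.\<close>

lemma (in graph) skew_rounds_near_initial:
  fixes f :: "'a \<Rightarrow> int"
  assumes deg: "\<And>v. v \<in> verts G \<Longrightarrow> out_degree G v \<ge> 2"
    and lip: "\<And>x y. x \<rightarrow>\<^bsub>G\<^esub> y \<Longrightarrow> \<bar>f x - f y\<bar> \<le> 1"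
    and "x \<in> (skew_round G ^^ k) S"
  shows "\<exists>s\<in>S. \<bar>f x - f s\<bar> \<le> 2 * int k"
  using assms(3)
proof (induction k arbitrary: x)
  case 0
  then show ?case by force
next
  case (Suc k)
  let ?B = "(skew_round G ^^ k) S"
  show ?case
  proof (cases "x \<in> ?B")
    case True
    then obtain s where "s \<in> S" "\<bar>f x - f s\<bar> \<le> 2 * int k" using Suc.IH by blast
    then show ?thesis by (intro bexI[of _ s]) auto
  next
    case False
    with Suc.prems obtain v where v: "v \<in> verts G" "neighbors G v - ?B = {x}"
      by (auto simp: skew_round_def[of G ?B])
    \<comment> \<open>Degree at least two gives \<open>v\<close> a neighbor \<open>y\<close> other
      than \<open>x\<close>. Since \<open>x\<close> is the only white neighbor, \<open>y\<close> is
      already blue, and the detour from \<open>y\<close> through \<open>v\<close> to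
      \<open>x\<close> costs 2 per round.\<close>
    have "\<not> neighbors G v \<subseteq> {x}"
    proof
      assume "neighbors G v \<subseteq> {x}"
      then have "card (neighbors G v) \<le> 1"
        by (metis card_mono card.empty card_insert_disjoint empty_iff finite.simps One_nat_def)
      with deg[OF v(1)] show False by (simp add: card_neighbors)
    qed
    then obtain y where y: "y \<in> neighbors G v" "y \<noteq> x" by blast
    with v(2) have "y \<in> ?B" by blast
    with Suc.IH obtain s where s: "s \<in> S" "\<bar>f y - f s\<bar> \<le> 2 * int k" by blast
    have "v \<rightarrow>\<^bsub>G\<^esub> x" "v \<rightarrow>\<^bsub>G\<^esub> y" using v(2) y(1) by (auto simp: neighbors_def)
    from this[THEN lip] s show ?thesis by (intro bexI[of _ s]) auto
  qed
qed

lemma card_le_covering_intervals: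
  fixes A :: "int set"
  assumes "finite S" and cover: "\<And>i. i \<in> A \<Longrightarrow> \<exists>s\<in>S. \<bar>i - f s\<bar> \<le> int r"
  shows "card A \<le> card S * (2 * r + 1)"
proof -
  have "A \<subseteq> (\<Union>s\<in>S. {f s - int r..f s + int r})"
  proof
    fix i assume "i \<in> A"
    with cover obtain s where "s \<in> S" "\<bar>i - f s\<bar> \<le> int r" by blast
    then show "i \<in> (\<Union>s\<in>S. {f s - int r..f s + int r})" by force
  qed
  then have "card A \<le> card (\<Union>s\<in>S. {f s - int r..f s + int r})"
    using \<open>finite S\<close> by (intro card_mono) auto
  also have "\<dots> \<le> (\<Sum>s\<in>S. card {f s - int r..f s + int r})"
    using \<open>finite S\<close> by (rule card_UN_le)
  also have "\<dots> = card S * (2 * r + 1)"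
    by (simp add: nat_add_distrib nat_mult_distrib algebra_simps)
  finally show ?thesis .
qed

lemma (in graph) diameter_level_function:
  assumes conn: "Digraph_Component.connected G"
    and diam: "diameter G = ereal (real d)"
  obtains f :: "'a \<Rightarrow> nat"
  where "\<And>x y. x \<rightarrow>\<^bsub>G\<^esub> y \<Longrightarrow> \<bar>int (f x) - int (f y)\<bar> \<le> 1" "{..d} \<subseteq> f ` verts G"
proof -
  have reach: "u \<rightarrow>\<^sup>* v" if "u \<in> verts G" "v \<in> verts G" for u v
    using symmetric_connected_imp_strongly_connected[OF sym_arcs conn] that
    by (auto simp: strongly_connected_def)
  \<comment> \<open>The slack of 1 yields a pair without showing that the supremum is attained; as
    distances are integers, more than \<open>d - 1\<close> means at least \<open>d\<close>.\<close>
  have "ereal (real d - 1) < diameter G" using diam by simp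
  then obtain u v where uv: "u \<in> verts G" "v \<in> verts G" "ereal (real d - 1) < graph_dist G u v"
    by (auto simp: diameter_def less_SUP_iff)
  define f where "f x = (SOME n::nat. graph_dist G u x = ereal (real n))" for x
  have f: "graph_dist G u x = ereal (real (f x))" if "x \<in> verts G" for x
    unfolding f_def using graph_dist_eq_nat[OF reach[OF uv(1) that]] by (rule someI_ex)
  have le: "f y \<le> f x + 1" if "x \<rightarrow>\<^bsub>G\<^esub> y" for x y
    using graph_dist_adj[OF that, of u] f[of x] f[of y] adj_in_verts[OF that]
    by (simp add: one_ereal_def)
  have "\<bar>int (f x) - int (f y)\<bar> \<le> 1" if "x \<rightarrow>\<^bsub>G\<^esub> y" for x y
    using le[OF that] le[OF graph_symmetric[OF that]] by linarith
  \<comment> \<open>The bound \<le> 0 suffices because \<open>f u\<close> is a natural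
    number.\<close>
  moreover have "f u = 0"
    using graph_dist_self[OF wf_digraph uv(1)] f[OF uv(1)] by (simp add: zero_ereal_def)
  then have "{..f v} \<subseteq> f ` verts G"
    using reachable_all_levels[OF reach[OF uv(1,2)]] le by blast
  moreover have "d \<le> f v" using uv(3) f[OF uv(2)] by simp
  ultimately show thesis using that[of f] by fastforce
qed

lemma (in graph) diameter_bound_forcing:
  assumes "Digraph_Component.connected G" "diameter G = ereal (real d)"
    and deg: "\<And>v. v \<in> verts G \<Longrightarrow> out_degree G v \<ge> 2"
    and "S \<subseteq> verts G" and forced: "(skew_round G ^^ t) S = verts G"
  shows "d + 1 \<le> card S * (4 * t + 1)"
proof -
  obtain f :: "'a \<Rightarrow> nat" where lip: "\<And>x y. x \<rightarrow>\<^bsub>G\<^esub> y \<Longrightarrow> \<bar>int (f x) - int (f y)\<bar> \<le> 1"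
    and levels: "{..d} \<subseteq> f ` verts G"
    using diameter_level_function assms(1,2) by blast
  have "finite S" using \<open>S \<subseteq> verts G\<close> finite_verts by (rule finite_subset)
  \<comment> \<open>A vertex on level \<open>i\<close> is blue after \<open>t\<close> rounds, hence
    within \<open>2 * t\<close> levels of \<open>S\<close>; intervals of this radius have
    \<open>4 * t + 1\<close> points.\<close>
  have "\<exists>s\<in>S. \<bar>i - int (f s)\<bar> \<le> int (2 * t)" if i: "i \<in> int ` {..d}" for i
  proof -
    obtain x where "x \<in> verts G" "i = int (f x)" using i levels by blast
    with skew_rounds_near_initial[of "\<lambda>x. int (f x)" x t S] deg lip forced show ?thesis by simp
  qed
  from card_le_covering_intervals[OF \<open>finite S\<close>, of "int ` {..d}", OF this] show ?thesis
    by (simp add: card_image)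
qed

text \<open>Sets that never force everything have value \<infinity>; for the others the least number
  of rounds is attained, so finite pairs \<open>S\<close>, \<open>t\<close> suffice.\<close>

lemma le_skew_throttling_numberI:
  assumes "\<And>S t. \<lbrakk>S \<subseteq> verts G; (skew_round G ^^ t) S = verts G\<rbrakk> \<Longrightarrow> m \<le> card S + t"
  shows "enat m \<le> skew_throttling_number G"
  unfolding skew_throttling_number_def
proof (rule INF_greatest)
  fix S assume S: "S \<in> Pow (verts G)"
  let ?T = "{k. (skew_round G ^^ k) S = verts G}"
  show "enat m \<le> skew_throttling_of G S"
  proof (cases "?T = {}")
    case True
    then show ?thesis by (simp add: skew_throttling_of_def skew_prop_time_def top_enat_def)
  next
    case False
    then have "Inf (enat ` ?T) \<in> enat ` ?T" by (auto intro: wellorder_InfI)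
    then obtain t where "t \<in> ?T" "skew_prop_time G S = enat t"
      unfolding skew_prop_time_def by blast
    with assms S show ?thesis by (simp add: skew_throttling_of_def)
  qed
qed

theorem theorem3p13:
  fixes G :: "('a, 'b) pre_digraph" and d :: nat
  assumes "graph G"
    and "Digraph_Component.connected G"
    and "diameter G = ereal (real d)"
    and "d \<ge> 4"
    and "min_degree G \<ge> 2"
  shows "ereal_of_enat (skew_throttling_number G) \<ge> ereal (sqrt (real d) - 1 / 4)"
proof -
  interpret graph G by fact
  have deg: "out_degree G v \<ge> 2" if "v \<in> verts G" for v
    using Min_le[of "out_degree G ` verts G" "out_degree G v"] that \<open>min_degree G \<ge> 2\<close>
    by (simp add: min_degree_def order_trans)
  \<comment> \<open>Rounding up moves the real bound into \<open>enat\<close>; nothing is lost,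
    since \<open>card S + t\<close> is an integer.\<close>
  define m where "m = nat \<lceil>sqrt (real d) - 1 / 4\<rceil>"
  have "enat m \<le> skew_throttling_number G"
  proof (rule le_skew_throttling_numberI)
    fix S t assume "S \<subseteq> verts G" "(skew_round G ^^ t) S = verts G"
    from diameter_bound_forcing[OF assms(2,3) deg this]
    have "real (d + 1) \<le> real (card S * (4 * t + 1))" by (simp only: of_nat_le_iff)
    \<comment> \<open>AM-GM for \<open>card S\<close> and \<open>t + 1 / 4\<close>, whose product is
      a quarter of \<open>card S * (4 * t + 1)\<close>; this is the source of the 1/4.\<close>
    moreover have "(real (card S) + real t + 1 / 4)\<^sup>2 - real (card S * (4 * t + 1))
        = (real (card S) - real t - 1 / 4)\<^sup>2"
      by (simp add: power2_eq_square algebra_simps)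
    moreover have "(real (card S) - real t - 1 / 4)\<^sup>2 \<ge> 0" by simp
    ultimately have "real d \<le> (real (card S) + real t + 1 / 4)\<^sup>2" by linarith
    then have "sqrt (real d) \<le> real (card S) + real t + 1 / 4"
      by (intro real_le_lsqrt) auto
    then show "m \<le> card S + t" unfolding m_def by linarith
  qed
  then have "ereal_of_enat (enat m) \<le> ereal_of_enat (skew_throttling_number G)"
    by (simp only: ereal_of_enat_le_iff)
  moreover have "sqrt (real d) - 1 / 4 \<le> real m" unfolding m_def by linarith
  ultimately show ?thesis by (metis ereal_less_eq(3) ereal_of_enat_simps(1) order_trans)
qed

end
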